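(* Every $T$-structure $(A, 0, 1, \wedge, \vee, C, S_1, S_2)$ is isomorphic to a $T$-structure of relations; that is, there exist a nonempty set $E$, a symmetric relation $\rho \subseteq E \times E$, and a family $\mathcal{F}$ of subsets of $\rho$ containing $\emptyset$ and $\rho$, closed under $\cap$, $\cup$ and the operations $S_1(R) = R \cap R^{-1}$, $S_2(R) = R \cup R^{-1}$, $C(R) = \rho \setminus (R \cap R^{-1})$, such that $(\mathcal{F}, \emptyset, \rho, \cap, \cup, C, S_1, S_2)$ is a $T$-structure and there is a bijection $h : A \to \mathcal{F}$ with $h(0)=\emptyset$, $h(1)=\rho$, $h(a \wedge b) = h(a) \cap h(b)$, $h(a \vee b) = h(a) \cup h(b)$, $h(S_1 a) = S_1 h(a)$, $h(S_2 a) = S_2 h(a)$ and $h(C a) = C h(a)$ for all $a, b \in A$.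
   Context: A $T$-structure is an algebra $(A, 0, 1, \wedge, \vee, C, S_1, S_2)$ where $0,1$ are constants, $C, S_1, S_2$ are unary operations and $\wedge, \vee$ are binary operations, such that: (T1) $(A, 0, 1, \wedge, \vee)$ is a distributive lattice with least element $0$ and greatest element $1$; and for all $a, b \in A$ and all $i, j \in \{1,2\}$: (T2) $S_i(a \wedge b) = S_i a \wedge S_i b$ and $S_i(a \vee b) = S_i a \vee S_i b$; (T3) $S_1 a \wedge C a = 0$ and $S_1 a \vee C a = 1$; (T4) $S_i S_j a = S_j a$; (T5) $S_1 0 = 0$ and $S_1 1 = 1$; (T6) if $S_i a = S_i b$ for both $i = 1, 2$, then $a = b$; (T7) $S_1 a \leq S_2 a$. For a binary relation $R$, $R^{-1} = \{(y,x) : (x,y) \in R\}$. A relation $\rho \subseteq E \times E$ is symmetric if $\rho^{-1} = \rho$. *)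

theory Defs
  imports Main
begin

locale dist_lattice_on =
  fixes A :: "'a set"
    and meet :: "'a \<Rightarrow> 'a \<Rightarrow> 'a" (infixl "\<sqinter>" 70)
    and join :: "'a \<Rightarrow> 'a \<Rightarrow> 'a" (infixl "\<squnion>" 65)
  assumes meet_closed: "\<lbrakk>a \<in> A; b \<in> A\<rbrakk> \<Longrightarrow> a \<sqinter> b \<in> A"
    and join_closed: "\<lbrakk>a \<in> A; b \<in> A\<rbrakk> \<Longrightarrow> a \<squnion> b \<in> A"
    and meet_commute: "\<lbrakk>a \<in> A; b \<in> A\<rbrakk> \<Longrightarrow> a \<sqinter> b = b \<sqinter> a"
    and join_commute: "\<lbrakk>a \<in> A; b \<in> A\<rbrakk> \<Longrightarrow> a \<squnion> b = b \<squnion> a"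
    and meet_assoc: "\<lbrakk>a \<in> A; b \<in> A; c \<in> A\<rbrakk> \<Longrightarrow> (a \<sqinter> b) \<sqinter> c = a \<sqinter> (b \<sqinter> c)"
    and join_assoc: "\<lbrakk>a \<in> A; b \<in> A; c \<in> A\<rbrakk> \<Longrightarrow> (a \<squnion> b) \<squnion> c = a \<squnion> (b \<squnion> c)"
    and meet_absorb: "\<lbrakk>a \<in> A; b \<in> A\<rbrakk> \<Longrightarrow> a \<sqinter> (a \<squnion> b) = a"
    and join_absorb: "\<lbrakk>a \<in> A; b \<in> A\<rbrakk> \<Longrightarrow> a \<squnion> (a \<sqinter> b) = a"
    and meet_distrib:
      "\<lbrakk>a \<in> A; b \<in> A; c \<in> A\<rbrakk> \<Longrightarrow> a \<sqinter> (b \<squnion> c) = (a \<sqinter> b) \<squnion> (a \<sqinter> c)"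
begin

definition leq :: "'a \<Rightarrow> 'a \<Rightarrow> bool" (infix "\<sqsubseteq>" 50)
  where "a \<sqsubseteq> b \<longleftrightarrow> a \<sqinter> b = a"

end

locale T_structure = dist_lattice_on A meet join
  for A :: "'a set"
    and zero :: 'a
    and one :: 'a
    and meet :: "'a \<Rightarrow> 'a \<Rightarrow> 'a" (infixl "\<sqinter>" 70)
    and join :: "'a \<Rightarrow> 'a \<Rightarrow> 'a" (infixl "\<squnion>" 65) +
  fixes C :: "'a \<Rightarrow> 'a"
    and S1 :: "'a \<Rightarrow> 'a"
    and S2 :: "'a \<Rightarrow> 'a"
  assumes zero_closed: "zero \<in> A"
    and one_closed: "one \<in> A"
    and C_closed: "a \<in> A \<Longrightarrow> C a \<in> A"
    and S1_closed: "a \<in> A \<Longrightarrow> S1 a \<in> A"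
    and S2_closed: "a \<in> A \<Longrightarrow> S2 a \<in> A"
    and zero_least: "a \<in> A \<Longrightarrow> zero \<sqsubseteq> a"
    and one_greatest: "a \<in> A \<Longrightarrow> a \<sqsubseteq> one"
    and S1_meet: "\<lbrakk>a \<in> A; b \<in> A\<rbrakk> \<Longrightarrow> S1 (a \<sqinter> b) = S1 a \<sqinter> S1 b"
    and S1_join: "\<lbrakk>a \<in> A; b \<in> A\<rbrakk> \<Longrightarrow> S1 (a \<squnion> b) = S1 a \<squnion> S1 b"
    and S2_meet: "\<lbrakk>a \<in> A; b \<in> A\<rbrakk> \<Longrightarrow> S2 (a \<sqinter> b) = S2 a \<sqinter> S2 b"
    and S2_join: "\<lbrakk>a \<in> A; b \<in> A\<rbrakk> \<Longrightarrow> S2 (a \<squnion> b) = S2 a \<squnion> S2 b"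
    and S1_C_meet: "a \<in> A \<Longrightarrow> S1 a \<sqinter> C a = zero"
    and S1_C_join: "a \<in> A \<Longrightarrow> S1 a \<squnion> C a = one"
    and S1_S1: "a \<in> A \<Longrightarrow> S1 (S1 a) = S1 a"
    and S1_S2: "a \<in> A \<Longrightarrow> S1 (S2 a) = S2 a"
    and S2_S1: "a \<in> A \<Longrightarrow> S2 (S1 a) = S1 a"
    and S2_S2: "a \<in> A \<Longrightarrow> S2 (S2 a) = S2 a"
    and S1_zero: "S1 zero = zero"
    and S1_one: "S1 one = one"
    and S_eqI: "\<lbrakk>a \<in> A; b \<in> A; S1 a = S1 b; S2 a = S2 b\<rbrakk> \<Longrightarrow> a = b"
    and S1_le_S2: "a \<in> A \<Longrightarrow> S1 a \<sqsubseteq> S2 a"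

definition rel_S1 :: "'e rel \<Rightarrow> 'e rel"
  where "rel_S1 R = R \<inter> R\<inverse>"

definition rel_S2 :: "'e rel \<Rightarrow> 'e rel"
  where "rel_S2 R = R \<union> R\<inverse>"

definition rel_C :: "'e rel \<Rightarrow> 'e rel \<Rightarrow> 'e rel"
  where "rel_C \<rho> R = \<rho> - (R \<inter> R\<inverse>)"

definition T_structure_of_relations :: "'e set \<Rightarrow> 'e rel \<Rightarrow> 'e rel set \<Rightarrow> bool"
  where "T_structure_of_relations E \<rho> F \<longleftrightarrow>
    E \<noteq> {} \<and> \<rho> \<subseteq> E \<times> E \<and> \<rho>\<inverse> = \<rho> \<and>
    F \<subseteq> Pow \<rho> \<and> {} \<in> F \<and> \<rho> \<in> F \<and>
    (\<forall>R\<in>F. \<forall>Q\<in>F. R \<inter> Q \<in> F \<and> R \<union> Q \<in> F) \<and>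
    (\<forall>R\<in>F. rel_S1 R \<in> F \<and> rel_S2 R \<in> F \<and> rel_C \<rho> R \<in> F) \<and>
    T_structure F {} \<rho> (\<inter>) (\<union>) (rel_C \<rho>) rel_S1 rel_S2"

end

theory Submission
  imports Defs
begin

text \<open>
  For a prime filter \<open>P\<close> put \<open>P\<^sub>i = {a. S\<^sub>i a \<in> P}\<close>; these are prime filters with \<open>P\<^sub>1 \<subseteq> P\<^sub>2\<close>.
  Let \<open>\<rho>\<close> consist of all pairs \<open>(P\<^sub>1, P\<^sub>2)\<close> and \<open>(P\<^sub>2, P\<^sub>1)\<close>, and let \<open>h a\<close> be the set of those pairs
  of \<open>\<rho>\<close> whose second component contains \<open>a\<close>. Since elements of the form \<open>S\<^sub>i a\<close> are fixed by
  \<open>S\<^sub>1\<close> and \<open>S\<^sub>2\<close>, for \<open>(x, y) \<in> \<rho>\<close> we have \<open>S\<^sub>1 a \<in> y\<close> iff \<open>a \<in> x \<inter> y\<close>, and \<open>S\<^sub>2 a \<in> y\<close> iff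
  \<open>a \<in> x \<union> y\<close>; hence \<open>h\<close> is a homomorphism. It is injective by (T6) and the prime filter theorem.
\<close>

section \<open>The order of a distributive lattice\<close>

context dist_lattice_on
begin

lemma meet_idem: "a \<in> A \<Longrightarrow> a \<sqinter> a = a"
  using meet_absorb[of a "a \<sqinter> a"] by (simp add: join_absorb meet_closed)

lemma leq_refl: "a \<in> A \<Longrightarrow> a \<sqsubseteq> a"
  by (simp add: leq_def meet_idem)

lemma leq_antisym: "\<lbrakk>a \<in> A; b \<in> A; a \<sqsubseteq> b; b \<sqsubseteq> a\<rbrakk> \<Longrightarrow> a = b"
  unfolding leq_def by (metis meet_commute)

lemma leq_trans: "\<lbrakk>a \<in> A; b \<in> A; c \<in> A; a \<sqsubseteq> b; b \<sqsubseteq> c\<rbrakk> \<Longrightarrow> a \<sqsubseteq> c"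
  unfolding leq_def by (metis meet_assoc)

lemma meet_leq1: "\<lbrakk>a \<in> A; b \<in> A\<rbrakk> \<Longrightarrow> a \<sqinter> b \<sqsubseteq> a"
  using meet_assoc[of a a b] meet_assoc[of a b a]
  by (simp add: leq_def meet_idem meet_closed meet_commute[of _ a])

lemma meet_leq2: "\<lbrakk>a \<in> A; b \<in> A\<rbrakk> \<Longrightarrow> a \<sqinter> b \<sqsubseteq> b"
  by (metis meet_commute meet_leq1)

lemma meet_greatest: "\<lbrakk>a \<in> A; b \<in> A; c \<in> A; c \<sqsubseteq> a; c \<sqsubseteq> b\<rbrakk> \<Longrightarrow> c \<sqsubseteq> a \<sqinter> b"
  unfolding leq_def by (metis meet_assoc)

lemma meet_mono:
  "\<lbrakk>a \<in> A; b \<in> A; c \<in> A; d \<in> A; a \<sqsubseteq> c; b \<sqsubseteq> d\<rbrakk> \<Longrightarrow> a \<sqinter> b \<sqsubseteq> c \<sqinter> d"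
  using leq_trans[of "a \<sqinter> b" a c] leq_trans[of "a \<sqinter> b" b d]
  by (simp add: meet_closed meet_greatest meet_leq1 meet_leq2)

lemma join_leq1: "\<lbrakk>a \<in> A; b \<in> A\<rbrakk> \<Longrightarrow> a \<sqsubseteq> a \<squnion> b"
  by (simp add: leq_def meet_absorb)

lemma join_leq2: "\<lbrakk>a \<in> A; b \<in> A\<rbrakk> \<Longrightarrow> b \<sqsubseteq> a \<squnion> b"
  by (metis join_commute join_leq1)

text \<open>Distributivity enters because the order is defined through meets:
  \<open>c \<sqinter> (a \<squnion> b)\<close> expands to
  \<open>(c \<sqinter> a) \<squnion> (c \<sqinter> b)\<close>, which is
  \<open>a \<squnion> b\<close>.\<close>

lemma join_least: "\<lbrakk>a \<in> A; b \<in> A; c \<in> A; a \<sqsubseteq> c; b \<sqsubseteq> c\<rbrakk> \<Longrightarrow> a \<squnion> b \<sqsubseteq> c"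
  using meet_distrib[of c a b]
  by (simp add: leq_def join_closed meet_commute[of c])

section \<open>Filters and the prime filter theorem\<close>

definition lattice_filter :: "'a set \<Rightarrow> bool"
  where "lattice_filter P \<longleftrightarrow> P \<subseteq> A \<and> (\<forall>x\<in>P. \<forall>y\<in>P. x \<sqinter> y \<in> P)
    \<and> (\<forall>x\<in>P. \<forall>y\<in>A. x \<sqsubseteq> y \<longrightarrow> y \<in> P)"

text \<open>The equivalence for meets packs closure under meets and upward closure into one
  condition, since \<open>x \<sqsubseteq> y\<close> means \<open>x \<sqinter> y = x\<close>. Such
  sets are the inverse images of the top under lattice homomorphisms from \<open>A\<close> onto the
  two-element chain.\<close>

definition prime_filter :: "'a set \<Rightarrow> bool"
  where "prime_filter P \<longleftrightarrow> P \<noteq> {} \<and> P \<subset> A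
    \<and> (\<forall>x\<in>A. \<forall>y\<in>A. x \<sqinter> y \<in> P \<longleftrightarrow> x \<in> P \<and> y \<in> P)
    \<and> (\<forall>x\<in>A. \<forall>y\<in>A. x \<squnion> y \<in> P \<longleftrightarrow> x \<in> P \<or> y \<in> P)"

lemma prime_filter_meet:
  "\<lbrakk>prime_filter P; x \<in> A; y \<in> A\<rbrakk> \<Longrightarrow> x \<sqinter> y \<in> P \<longleftrightarrow> x \<in> P \<and> y \<in> P"
  by (simp add: prime_filter_def)

lemma prime_filter_join:
  "\<lbrakk>prime_filter P; x \<in> A; y \<in> A\<rbrakk> \<Longrightarrow> x \<squnion> y \<in> P \<longleftrightarrow> x \<in> P \<or> y \<in> P"
  by (simp add: prime_filter_def)

lemma prime_filter_mono:
  "\<lbrakk>prime_filter P; x \<in> P; y \<in> A; x \<sqsubseteq> y\<rbrakk> \<Longrightarrow> y \<in> P"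
  unfolding leq_def prime_filter_def by (metis psubsetD)

lemma lattice_filter_principal: "a \<in> A \<Longrightarrow> lattice_filter {x \<in> A. a \<sqsubseteq> x}"
  unfolding lattice_filter_def
  by (auto intro: meet_closed meet_greatest leq_trans)

text \<open>Members of a chain are comparable, so two elements of the union lie in a common member,
  which contains their meet.\<close>

lemma lattice_filter_Union_chain:
  assumes "subset.chain {P. lattice_filter P} K"
  shows "lattice_filter (\<Union>K)"
proof -
  have K: "lattice_filter P" if "P \<in> K" for P
    using that assms by (auto simp: subset_chain_def)
  have "x \<sqinter> y \<in> \<Union>K" if "P \<in> K" "x \<in> P" "Q \<in> K" "y \<in> Q" for x y P Q
  proof -
    have "P \<subseteq> Q \<or> Q \<subseteq> P"
      using assms that by (auto simp: subset_chain_def)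
    with that K[of P] K[of Q] show ?thesis
      unfolding lattice_filter_def by blast
  qed
  with K show ?thesis
    unfolding lattice_filter_def by blast
qed

text \<open>\<open>N\<close> is the filter generated by \<open>M\<close> and \<open>x\<close>; it is
  the competitor against which a maximal filter is tested.\<close>

lemma lattice_filter_extend:
  assumes M: "lattice_filter M" "M \<noteq> {}" and x: "x \<in> A"
  defines "N \<equiv> {z \<in> A. \<exists>m\<in>M. m \<sqinter> x \<sqsubseteq> z}"
  shows "lattice_filter N" "M \<subseteq> N" "x \<in> N"
proof -
  have MA: "m \<in> A" if "m \<in> M" for m
    using M that by (auto simp: lattice_filter_def)
  show "M \<subseteq> N"
    using MA x meet_leq1 by (auto simp: N_def)
  show "x \<in> N"
    using MA x meet_leq2 M(2) by (auto simp: N_def)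
  have "z \<sqinter> w \<in> N" if zwN: "z \<in> N" "w \<in> N" for z w
  proof -
    obtain m n where m: "m \<in> M" "m \<sqinter> x \<sqsubseteq> z" and n: "n \<in> M" "n \<sqinter> x \<sqsubseteq> w"
      using zwN unfolding N_def by blast
    have zw: "z \<in> A" "w \<in> A" using zwN by (auto simp: N_def)
    have mn: "m \<sqinter> n \<in> M" using M m n by (auto simp: lattice_filter_def)
    have "(m \<sqinter> n) \<sqinter> x \<sqsubseteq> m \<sqinter> x" "(m \<sqinter> n) \<sqinter> x \<sqsubseteq> n \<sqinter> x"
      using MA m n x by (auto intro!: meet_mono meet_leq1 meet_leq2 leq_refl meet_closed)
    then have "(m \<sqinter> n) \<sqinter> x \<sqsubseteq> z \<sqinter> w"
      using m n MA x zw mn leq_trans[of "(m \<sqinter> n) \<sqinter> x" "m \<sqinter> x" z]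
        leq_trans[of "(m \<sqinter> n) \<sqinter> x" "n \<sqinter> x" w]
      by (simp add: meet_closed meet_greatest)
    with mn zw show ?thesis by (auto simp: N_def meet_closed)
  qed
  moreover have "w \<in> N" if zw: "z \<in> N" "w \<in> A" "z \<sqsubseteq> w" for z w
  proof -
    obtain m where "m \<in> M" "m \<sqinter> x \<sqsubseteq> z" "z \<in> A"
      using zw unfolding N_def by blast
    then show ?thesis
      using zw MA x leq_trans[of "m \<sqinter> x" z w] unfolding N_def by (auto intro: meet_closed)
  qed
  ultimately show "lattice_filter N"
    unfolding lattice_filter_def N_def by blast
qed

text \<open>Zorn's lemma yields a filter maximal among those that contain \<open>a\<close> and miss
  \<open>b\<close>; maximality and distributivity force it to be prime.\<close>

theorem prime_filter_separation:
  assumes a: "a \<in> A" and b: "b \<in> A" and ab: "\<not> a \<sqsubseteq> b"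
  shows "\<exists>P. prime_filter P \<and> a \<in> P \<and> b \<notin> P"
proof -
  define \<F> where "\<F> = {P. lattice_filter P \<and> a \<in> P \<and> b \<notin> P}"
  have "{x \<in> A. a \<sqsubseteq> x} \<in> \<F>"
    using a ab lattice_filter_principal leq_refl by (auto simp: \<F>_def)
  then have "\<exists>M\<in>\<F>. \<forall>P\<in>\<F>. M \<subseteq> P \<longrightarrow> P = M"
  proof (intro subset_Zorn_nonempty)
    \<comment> \<open>Since the chain is nonempty, \<open>a\<close> lies in its union.\<close>
    fix K assume K: "K \<noteq> {}" "subset.chain \<F> K"
    then have "subset.chain {P. lattice_filter P} K"
      by (auto simp: subset_chain_def \<F>_def)
    with K lattice_filter_Union_chain show "\<Union>K \<in> \<F>"
      by (auto simp: subset_chain_def \<F>_def)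
  qed auto
  then obtain M where M: "lattice_filter M" "a \<in> M" "b \<notin> M"
    and max: "\<And>P. \<lbrakk>lattice_filter P; a \<in> P; b \<notin> P; M \<subseteq> P\<rbrakk> \<Longrightarrow> P = M"
    by (auto simp: \<F>_def)
  have MA: "m \<in> A" if "m \<in> M" for m
    using M that by (auto simp: lattice_filter_def)
  have up: "y \<in> M" if "x \<in> M" "y \<in> A" "x \<sqsubseteq> y" for x y
    using M that by (auto simp: lattice_filter_def)
  \<comment> \<open>Otherwise the filter generated by \<open>M\<close> and \<open>x\<close> would
    still miss \<open>b\<close>, so by maximality it would be \<open>M\<close> and \<open>x\<close>
    would lie in \<open>M\<close>.\<close>
  have ext: "\<exists>m\<in>M. m \<sqinter> x \<sqsubseteq> b" if x: "x \<in> A" "x \<notin> M" for x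
  proof (rule ccontr)
    assume "\<not> ?thesis"
    then have "{z \<in> A. \<exists>m\<in>M. m \<sqinter> x \<sqsubseteq> z} = M"
      using lattice_filter_extend[OF M(1) _ x(1)] M by (intro max) auto
    then show False
      using lattice_filter_extend[OF M(1) _ x(1)] M x by auto
  qed
  have prime: "x \<in> M \<or> y \<in> M" if xy: "x \<in> A" "y \<in> A" "x \<squnion> y \<in> M" for x y
  proof (rule ccontr)
    assume "\<not> ?thesis"
    then obtain m n where m: "m \<in> M" "m \<sqinter> x \<sqsubseteq> b" and n: "n \<in> M" "n \<sqinter> y \<sqsubseteq> b"
      using ext xy by blast
    \<comment> \<open>A common lower bound of both witnesses lets distributivity merge the two
      inequalities into one for \<open>x \<squnion> y\<close>, which puts \<open>b\<close> into
      \<open>M\<close>.\<close>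
    let ?k = "m \<sqinter> n"
    have k: "?k \<in> M" using M m n by (auto simp: lattice_filter_def)
    have "?k \<sqinter> x \<sqsubseteq> m \<sqinter> x" "?k \<sqinter> y \<sqsubseteq> n \<sqinter> y"
      using MA m n xy by (auto intro!: meet_mono meet_leq1 meet_leq2 leq_refl meet_closed)
    then have "?k \<sqinter> x \<sqsubseteq> b" "?k \<sqinter> y \<sqsubseteq> b"
      using MA m n xy b leq_trans[of "?k \<sqinter> x" "m \<sqinter> x" b] leq_trans[of "?k \<sqinter> y" "n \<sqinter> y" b]
      by (simp_all add: meet_closed)
    then have "?k \<sqinter> (x \<squnion> y) \<sqsubseteq> b"
      using MA k xy b by (simp add: meet_distrib join_least meet_closed)
    moreover have "?k \<sqinter> (x \<squnion> y) \<in> M"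
      using M k xy by (auto simp: lattice_filter_def)
    ultimately show False using up M b by blast
  qed
  have "prime_filter M"
    unfolding prime_filter_def
  proof (intro conjI ballI iffI)
    show "M \<noteq> {}" "M \<subset> A" using M b MA by auto
  next
    fix x y assume "x \<in> A" "y \<in> A" "x \<sqinter> y \<in> M"
    then show "x \<in> M" "y \<in> M" using up meet_leq1 meet_leq2 by blast+
  next
    fix x y assume "x \<in> M \<and> y \<in> M"
    then show "x \<sqinter> y \<in> M" using M by (auto simp: lattice_filter_def)
  next
    fix x y assume "x \<in> A" "y \<in> A" "x \<squnion> y \<in> M"
    then show "x \<in> M \<or> y \<in> M" by (rule prime)
  next
    fix x y assume "x \<in> A" "y \<in> A" "x \<in> M \<or> y \<in> M"
    then show "x \<squnion> y \<in> M" using up[of _ "x \<squnion> y"] join_leq1 join_leq2 join_closed by blast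
  qed
  with M show ?thesis by blast
qed

end

section \<open>Prime filters of a T-structure\<close>

context T_structure
begin

lemma one_in_prime_filter:
  assumes "prime_filter P"
  shows "one \<in> P"
proof -
  obtain x where "x \<in> P" "x \<in> A"
    using assms by (auto simp: prime_filter_def)
  with assms show ?thesis
    using prime_filter_mono[of P x one] by (simp add: one_greatest one_closed)
qed

lemma zero_notin_prime_filter:
  assumes "prime_filter P"
  shows "zero \<notin> P"
proof -
  obtain x where "x \<notin> P" "x \<in> A"
    using assms by (auto simp: prime_filter_def)
  with assms show ?thesis
    using prime_filter_mono[of P zero x] by (auto simp: zero_least)
qed

text \<open>The axiom (T5) speaks of \<open>S1\<close> only, but \<open>zero\<close> is
  \<open>S1 zero\<close>, and \<open>S2\<close> fixes every value of \<open>S1\<close>.\<close>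

lemma S2_zero: "S2 zero = zero"
  using S2_S1[OF zero_closed] by (simp add: S1_zero)

lemma S2_one: "S2 one = one"
  using S2_S1[OF one_closed] by (simp add: S1_one)

text \<open>\<open>C a\<close> is the lattice complement of \<open>S1 a\<close>, and a prime filter
  contains exactly one element of a complementary pair.\<close>

lemma C_in_prime_filter:
  assumes "prime_filter P" "a \<in> A"
  shows "C a \<in> P \<longleftrightarrow> S1 a \<notin> P"
  using assms prime_filter_meet[of P "S1 a" "C a"] prime_filter_join[of P "S1 a" "C a"]
  by (auto simp: S1_C_meet S1_C_join S1_closed C_closed
      one_in_prime_filter zero_notin_prime_filter)

text \<open>This is \<open>P\<^sub>1\<close>. The restriction to \<open>A\<close> is there because
  the axioms leave \<open>S1\<close> unspecified outside the carrier.\<close>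

definition pre1 :: "'a set \<Rightarrow> 'a set"
  where "pre1 P = {a \<in> A. S1 a \<in> P}"

definition pre2 :: "'a set \<Rightarrow> 'a set"
  where "pre2 P = {a \<in> A. S2 a \<in> P}"

text \<open>\<open>S1\<close> is a bounded lattice endomorphism, and inverse images of prime filters
  under such maps are prime; \<open>one\<close> and \<open>zero\<close> witness that the preimage is
  nonempty and proper.\<close>

lemma prime_filter_pre1:
  assumes "prime_filter P"
  shows "prime_filter (pre1 P)"
proof -
  have "one \<in> pre1 P" "zero \<notin> pre1 P"
    using assms one_in_prime_filter zero_notin_prime_filter one_closed
    by (auto simp: pre1_def S1_one S1_zero)
  with assms zero_closed show ?thesis
    unfolding prime_filter_def[of "pre1 P"]
    by (auto simp: pre1_def S1_meet S1_join meet_closed join_closed S1_closed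
        prime_filter_meet prime_filter_join)
qed

lemma prime_filter_pre2:
  assumes "prime_filter P"
  shows "prime_filter (pre2 P)"
proof -
  have "one \<in> pre2 P" "zero \<notin> pre2 P"
    using assms one_in_prime_filter zero_notin_prime_filter one_closed
    by (auto simp: pre2_def S2_one S2_zero)
  with assms zero_closed show ?thesis
    unfolding prime_filter_def[of "pre2 P"]
    by (auto simp: pre2_def S2_meet S2_join meet_closed join_closed S2_closed
        prime_filter_meet prime_filter_join)
qed

lemma pre1_subset_pre2: "prime_filter P \<Longrightarrow> pre1 P \<subseteq> pre2 P"
  using prime_filter_mono[OF _ _ S2_closed S1_le_S2] by (auto simp: pre1_def pre2_def)

section \<open>The relations that represent the elements\<close>

definition rep_top :: "'a set rel"
  where "rep_top = (\<Union>P\<in>Collect prime_filter. {(pre1 P, pre2 P), (pre2 P, pre1 P)})"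

text \<open>Testing only the second component makes the converse of \<open>rep a\<close> test the
  first, because \<open>rep_top\<close> is symmetric. Meeting or joining with the converse thus asks
  for \<open>a\<close> in both components or in at least one.\<close>

definition rep :: "'a \<Rightarrow> 'a set rel"
  where "rep a = {(x, y) \<in> rep_top. a \<in> y}"

lemma rep_top_cases:
  assumes "(x, y) \<in> rep_top"
  obtains P where "prime_filter P" "x = pre1 P" "y = pre2 P"
  | P where "prime_filter P" "x = pre2 P" "y = pre1 P"
  using assms by (auto simp: rep_top_def)

lemma converse_rep_top: "rep_top\<inverse> = rep_top"
  by (auto simp: rep_top_def)

lemma rep_top_swap: "(x, y) \<in> rep_top \<Longrightarrow> (y, x) \<in> rep_top"
  by (auto simp: rep_top_def)

lemma rep_top_prime_filter: "(x, y) \<in> rep_top \<Longrightarrow> prime_filter y"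
  by (elim rep_top_cases) (auto intro: prime_filter_pre1 prime_filter_pre2)

text \<open>As \<open>S1 a\<close> is fixed by both operators, it lies in \<open>pre1 P\<close> or
  \<open>pre2 P\<close> exactly when it lies in \<open>P\<close>, that is, when
  \<open>a \<in> pre1 P\<close>. By \<open>pre1_subset_pre2\<close>, \<open>pre1 P\<close> is the
  intersection of the two components.\<close>

lemma S1_in_rep_top_iff:
  assumes "(x, y) \<in> rep_top" "a \<in> A"
  shows "S1 a \<in> y \<longleftrightarrow> a \<in> x \<and> a \<in> y"
  using assms(1)
proof (cases rule: rep_top_cases)
  case (1 P)
  with assms(2) pre1_subset_pre2[of P] show ?thesis
    by (auto simp: pre1_def pre2_def S2_S1 S1_closed)
next
  case (2 P)
  with assms(2) pre1_subset_pre2[of P] show ?thesis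
    by (auto simp: pre1_def pre2_def S1_S1 S1_closed)
qed

text \<open>The same argument leads to \<open>a \<in> pre2 P\<close>, and \<open>pre2 P\<close> is
  the union of the two components.\<close>

lemma S2_in_rep_top_iff:
  assumes "(x, y) \<in> rep_top" "a \<in> A"
  shows "S2 a \<in> y \<longleftrightarrow> a \<in> x \<or> a \<in> y"
  using assms(1)
proof (cases rule: rep_top_cases)
  case (1 P)
  with assms(2) pre1_subset_pre2[of P] show ?thesis
    by (auto simp: pre1_def pre2_def S2_S2 S2_closed)
next
  case (2 P)
  with assms(2) pre1_subset_pre2[of P] show ?thesis
    by (auto simp: pre1_def pre2_def S1_S2 S2_closed)
qed

lemma C_in_rep_top_iff:
  "\<lbrakk>(x, y) \<in> rep_top; a \<in> A\<rbrakk> \<Longrightarrow> C a \<in> y \<longleftrightarrow> \<not> (a \<in> x \<and> a \<in> y)"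
  using C_in_prime_filter[OF rep_top_prime_filter] S1_in_rep_top_iff by simp

section \<open>The homomorphism, its injectivity and its image\<close>

lemma rep_zero: "rep zero = {}"
  using rep_top_prime_filter zero_notin_prime_filter by (auto simp: rep_def)

lemma rep_one: "rep one = rep_top"
  using rep_top_prime_filter one_in_prime_filter by (auto simp: rep_def)

lemma rep_meet: "\<lbrakk>a \<in> A; b \<in> A\<rbrakk> \<Longrightarrow> rep (a \<sqinter> b) = rep a \<inter> rep b"
  by (auto simp: rep_def prime_filter_meet dest: rep_top_prime_filter)

lemma rep_join: "\<lbrakk>a \<in> A; b \<in> A\<rbrakk> \<Longrightarrow> rep (a \<squnion> b) = rep a \<union> rep b"
  by (auto simp: rep_def prime_filter_join dest: rep_top_prime_filter)

lemma rep_S1: "a \<in> A \<Longrightarrow> rep (S1 a) = rel_S1 (rep a)"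
  by (auto simp: rep_def rel_S1_def S1_in_rep_top_iff dest: rep_top_swap)

lemma rep_S2: "a \<in> A \<Longrightarrow> rep (S2 a) = rel_S2 (rep a)"
  by (auto simp: rep_def rel_S2_def S2_in_rep_top_iff dest: rep_top_swap)

lemma rep_C: "a \<in> A \<Longrightarrow> rep (C a) = rel_C rep_top (rep a)"
  by (auto simp: rep_def rel_C_def C_in_rep_top_iff dest: rep_top_swap)

text \<open>Each prime filter \<open>P\<close> supplies two test pairs: the one ending in
  \<open>pre1 P\<close> detects \<open>S1 a \<in> P\<close>, the one ending in \<open>pre2 P\<close>
  detects \<open>S2 a \<in> P\<close>. Prime filter separation turns the resulting implications into
  inequalities.\<close>

lemma rep_leq_S:
  assumes "a \<in> A" "b \<in> A" "rep a \<subseteq> rep b"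
  shows "S1 a \<sqsubseteq> S1 b" "S2 a \<sqsubseteq> S2 b"
proof -
  have 1: "S1 b \<in> P" if "prime_filter P" "S1 a \<in> P" for P
  proof -
    have "(pre2 P, pre1 P) \<in> rep a"
      using that assms(1) by (auto simp: rep_def rep_top_def pre1_def)
    with assms(3) show ?thesis by (auto simp: rep_def pre1_def)
  qed
  have 2: "S2 b \<in> P" if "prime_filter P" "S2 a \<in> P" for P
  proof -
    have "(pre1 P, pre2 P) \<in> rep a"
      using that assms(1) by (auto simp: rep_def rep_top_def pre2_def)
    with assms(3) show ?thesis by (auto simp: rep_def pre2_def)
  qed
  show "S1 a \<sqsubseteq> S1 b"
    using 1 prime_filter_separation[OF S1_closed[OF assms(1)] S1_closed[OF assms(2)]] by metis
  show "S2 a \<sqsubseteq> S2 b"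
    using 2 prime_filter_separation[OF S2_closed[OF assms(1)] S2_closed[OF assms(2)]] by metis
qed

lemma inj_on_rep: "inj_on rep A"
proof (rule inj_onI)
  fix a b assume "a \<in> A" "b \<in> A" "rep a = rep b"
  then show "a = b"
    using S_eqI[of a b] rep_leq_S[of a b] rep_leq_S[of b a]
    by (simp add: leq_antisym S1_closed S2_closed)
qed

text \<open>Most axioms are identities of sets valid for all subrelations of the symmetric relation
  \<open>rep_top\<close>. Closure, and the laws that fail for general relations, are carried over
  from \<open>A\<close> along \<open>rep\<close>.\<close>

lemma T_structure_rep_image:
  "T_structure (rep ` A) {} rep_top (\<inter>) (\<union>) (rel_C rep_top) rel_S1 rel_S2"
proof -
  define F where "F = rep ` A"
  have closed: "R \<inter> Q \<in> F" "R \<union> Q \<in> F" if "R \<in> F" "Q \<in> F" for R Q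
    using that by (auto simp: F_def meet_closed join_closed simp flip: rep_meet rep_join)
  interpret R: dist_lattice_on F "(\<inter>)" "(\<union>)"
    by unfold_locales (blast intro: closed)+
  have top: "R \<subseteq> rep_top" if "R \<in> F" for R
    using that by (auto simp: F_def rep_def)
  have "T_structure F {} rep_top (\<inter>) (\<union>) (rel_C rep_top) rel_S1 rel_S2"
  proof unfold_locales
    show "{} \<in> F" "rep_top \<in> F"
      using zero_closed one_closed by (simp_all add: F_def flip: rep_zero rep_one)
  next
    fix R assume "R \<in> F"
    then obtain a where a: "a \<in> A" "R = rep a" by (auto simp: F_def)
    then show "rel_C rep_top R \<in> F" "rel_S1 R \<in> F" "rel_S2 R \<in> F"
      by (auto simp: F_def C_closed S1_closed S2_closed simp flip: rep_C rep_S1 rep_S2)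
  next
    fix R Q assume "R \<in> F" "Q \<in> F"
    then obtain a b where ab: "a \<in> A" "b \<in> A" "R = rep a" "Q = rep b" by (auto simp: F_def)
    \<comment> \<open>For arbitrary relations, symmetric part does not commute with union, nor
      symmetric closure with intersection; here both laws come from \<open>S1_join\<close> and
      \<open>S2_meet\<close> in \<open>A\<close>.\<close>
    have "rep (S1 (a \<squnion> b)) = rep (S1 a \<squnion> S1 b)" "rep (S2 (a \<sqinter> b)) = rep (S2 a \<sqinter> S2 b)"
      using ab by (simp_all add: S1_join S2_meet)
    then show "rel_S1 (R \<union> Q) = rel_S1 R \<union> rel_S1 Q" "rel_S2 (R \<inter> Q) = rel_S2 R \<inter> rel_S2 Q"
      using ab by (simp_all add: rep_S1 rep_S2 rep_meet rep_join
          S1_closed S2_closed meet_closed join_closed)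
  next
    fix R Q :: "'a set rel"
    assume "rel_S1 R = rel_S1 Q" "rel_S2 R = rel_S2 Q" and RQ: "R \<in> F" "Q \<in> F"
    moreover from RQ obtain a b where ab: "a \<in> A" "b \<in> A" "R = rep a" "Q = rep b" by (auto simp: F_def)
    \<comment> \<open>Arbitrary relations are not determined by their symmetric part and closure: a
      single pair of distinct points and its converse agree in both. Injectivity of
      \<open>rep\<close> brings the question back to \<open>S_eqI\<close> in
      \<open>A\<close>.\<close>
    ultimately have "rep (S1 a) = rep (S1 b)" "rep (S2 a) = rep (S2 b)"
      by (simp_all add: rep_S1 rep_S2)
    then have "S1 a = S1 b" "S2 a = S2 b"
      using ab by (simp_all add: inj_on_eq_iff[OF inj_on_rep] S1_closed S2_closed)
    then show "R = Q"
      using ab S_eqI[of a b] by simp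
  next
    fix R assume R: "R \<in> F"
    show "R.leq {} R" "R.leq R rep_top" "R.leq (rel_S1 R) (rel_S2 R)"
      using top[OF R] by (auto simp: R.leq_def rel_S1_def rel_S2_def)
    show "rel_S1 R \<inter> rel_C rep_top R = {}" "rel_S1 R \<union> rel_C rep_top R = rep_top"
      using top[OF R] by (auto simp: rel_S1_def rel_C_def)
  \<comment> \<open>The remaining laws are general set identities, except that \<open>rel_S1\<close>
    fixes \<open>rep_top\<close> by symmetry.\<close>
  qed (auto simp: rel_S1_def rel_S2_def converse_rep_top)
  then show ?thesis by (simp only: F_def)
qed

text \<open>Taking \<open>UNIV\<close> as the base set keeps it nonempty even when \<open>A\<close>
  has a single element; then there are no prime filters and \<open>rep_top\<close> is empty.\<close>

lemma T_structure_of_relations_rep: "T_structure_of_relations UNIV rep_top (rep ` A)"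
  unfolding T_structure_of_relations_def
proof (intro conjI)
  interpret R: T_structure "rep ` A" "{}" rep_top "(\<inter>)" "(\<union>)" "rel_C rep_top" rel_S1 rel_S2
    by (rule T_structure_rep_image)
  show "{} \<in> rep ` A" "rep_top \<in> rep ` A" by (fact R.zero_closed R.one_closed)+
  show "\<forall>R\<in>rep ` A. \<forall>Q\<in>rep ` A. R \<inter> Q \<in> rep ` A \<and> R \<union> Q \<in> rep ` A"
    by (intro ballI conjI R.meet_closed R.join_closed)
  show "\<forall>R\<in>rep ` A. rel_S1 R \<in> rep ` A \<and> rel_S2 R \<in> rep ` A \<and> rel_C rep_top R \<in> rep ` A"
    by (intro ballI conjI R.S1_closed R.S2_closed R.C_closed)
  show "rep ` A \<subseteq> Pow rep_top" by (auto simp: rep_def)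
qed (simp_all add: converse_rep_top T_structure_rep_image)

end

theorem theorem5p2:
  fixes A :: "'a set"
    and zero one :: 'a
    and meet join :: "'a \<Rightarrow> 'a \<Rightarrow> 'a"
    and C S1 S2 :: "'a \<Rightarrow> 'a"
  assumes "T_structure A zero one meet join C S1 S2"
  shows "\<exists>(E :: 'a set set) \<rho> F h.
    T_structure_of_relations E \<rho> F \<and>
    bij_betw h A F \<and>
    h zero = {} \<and>
    h one = \<rho> \<and>
    (\<forall>a\<in>A. \<forall>b\<in>A. h (meet a b) = h a \<inter> h b) \<and>
    (\<forall>a\<in>A. \<forall>b\<in>A. h (join a b) = h a \<union> h b) \<and>
    (\<forall>a\<in>A. h (S1 a) = rel_S1 (h a)) \<and>
    (\<forall>a\<in>A. h (S2 a) = rel_S2 (h a)) \<and>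
    (\<forall>a\<in>A. h (C a) = rel_C \<rho> (h a))"
proof -
  interpret T_structure A zero one meet join C S1 S2 by (rule assms)
  show ?thesis
    using T_structure_of_relations_rep inj_on_imp_bij_betw[OF inj_on_rep]
    by (intro exI[of _ UNIV] exI[of _ rep_top] exI[of _ "rep ` A"] exI[of _ rep])
      (simp add: rep_zero rep_one rep_meet rep_join rep_S1 rep_S2 rep_C)
qed

end
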